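(* Let $\phi:(0,\infty)\to(0,\infty)$ and $\rho>0$ be such that $Z(\rho,\phi)=1+\sum_{n=1}^{\infty}\frac{\rho^n}{\prod_{k=1}^n\phi(k)}<\infty$, and let $X$ be the random variable with values in $\mathbb{N}=\{0,1,2,\dots\}$ and probability mass function $$\mathbb{P}(X=0)=\frac{1}{Z(\rho,\phi)},\qquad \mathbb{P}(X=n)=\frac{\rho^n}{\prod_{k=1}^n\phi(k)}\,\frac{1}{Z(\rho,\phi)},\quad n\ge 1.$$ Then $X$ is overdispersed (underdispersed) if $d(n)=n/\phi(n)$, $n\in\{1,2,\dots\}$, is non-decreasing (non-increasing).
   Context: A random variable is called overdispersed if its variance-to-mean ratio is greater than $1$, and underdispersed if its variance-to-mean ratio is less than $1$.
   Formalization: Strict over-/underdispersion is proved for non-constant d; for constant d (X Poisson, ratio exactly 1) only the non-strict inequalities hold. Overdispersion also assumes E X finite, since non-decreasing d can give infinite mean, where the ratio is undefined. *)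

theory Defs
  imports "HOL-Probability.Probability"
begin

definition weight :: "real \<Rightarrow> (real \<Rightarrow> real) \<Rightarrow> nat \<Rightarrow> real" where
  "weight \<rho> \<phi> n = \<rho> ^ n / (\<Prod>k=1..n. \<phi> (real k))"

text \<open>The series is indexed from 0, so the summand with index \<open>n\<close> is the weight of \<open>n + 1\<close>.
  If the series diverges, \<open>partition_Z\<close> is a junk value: use it together with
  \<open>partition_Z_finite\<close>.\<close>

definition partition_Z_finite :: "real \<Rightarrow> (real \<Rightarrow> real) \<Rightarrow> bool" where
  "partition_Z_finite \<rho> \<phi> \<longleftrightarrow> summable (\<lambda>n. weight \<rho> \<phi> (Suc n))"

definition partition_Z :: "real \<Rightarrow> (real \<Rightarrow> real) \<Rightarrow> real" where
  "partition_Z \<rho> \<phi> = 1 + (\<Sum>n. weight \<rho> \<phi> (Suc n))"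

definition d_ratio :: "(real \<Rightarrow> real) \<Rightarrow> nat \<Rightarrow> real" where
  "d_ratio \<phi> n = real n / \<phi> (real n)"

text \<open>The variance is taken as an extended nonnegative integral, because the Bochner integral in
  \<open>prob_space.variance\<close> would be 0 for a variable of infinite variance. So the ratio of a variable
  with finite positive mean and infinite variance is \<open>\<infinity>\<close>.\<close>

definition variance_to_mean_ratio :: "'a measure \<Rightarrow> ('a \<Rightarrow> real) \<Rightarrow> ereal" where
  "variance_to_mean_ratio M Y =
     enn2ereal (\<integral>\<^sup>+ \<omega>. ennreal ((Y \<omega> - integral\<^sup>L M Y)\<^sup>2) \<partial>M) / ereal (integral\<^sup>L M Y)"

text \<open>Over- and underdispersion include that the ratio is meaningful, that is, that the mean
  exists, is finite and is nonzero.\<close>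

definition overdispersed :: "'a measure \<Rightarrow> ('a \<Rightarrow> real) \<Rightarrow> bool" where
  "overdispersed M Y \<longleftrightarrow>
     integrable M Y \<and> integral\<^sup>L M Y \<noteq> 0 \<and> variance_to_mean_ratio M Y > 1"

definition underdispersed :: "'a measure \<Rightarrow> ('a \<Rightarrow> real) \<Rightarrow> bool" where
  "underdispersed M Y \<longleftrightarrow>
     integrable M Y \<and> integral\<^sup>L M Y \<noteq> 0 \<and> variance_to_mean_ratio M Y < 1"

end

theory Submission imports Defs begin

text \<open>
  Write \<open>p n = P(X = n)\<close> and \<open>a n = \<rho> * d(n + 1)\<close>. The weights satisfy
  \<open>(n + 1) * p (n + 1) = a n * p n\<close>. Multiplying by \<open>f n\<close> and summing turns this recursion into
  the Stein identity \<open>E[X f(X - 1)] = E[a(X) f(X)]\<close>, which extends the one that characterises the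
  Poisson law (constant \<open>a\<close>). With \<open>f = 1\<close> it gives \<open>E X = E[a(X)]\<close>, with \<open>f n = n\<close> it gives
  \<open>E[X(X - 1)] = E[X a(X)]\<close>, and together
  \<open>Var X - E X = E[X a(X)] - E X * E[a(X)] = Cov(X, a(X))\<close>.

  By Chebyshev's association inequality this covariance is nonnegative if \<open>a\<close> is nondecreasing and
  nonpositive if \<open>a\<close> is nonincreasing. As every value of \<open>X\<close> has positive probability, it vanishes
  only if \<open>a\<close> is constant.

  As for integrability, a nonincreasing \<open>a\<close> is bounded by \<open>a 0\<close>, so the Stein identity bounds both
  \<open>E X\<close> and \<open>E[X(X - 1)]\<close>. For nondecreasing \<open>a\<close> the second moment may be infinite; then the
  variance-to-mean ratio is \<open>\<infinity>\<close>.
\<close>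

section \<open>The Stein identity\<close>

lemma (in prob_space) nn_integral_nat_valued:
  fixes X :: "'a \<Rightarrow> nat" and f :: "nat \<Rightarrow> ennreal"
  assumes X[measurable]: "X \<in> measurable M (count_space UNIV)"
  shows "(\<integral>\<^sup>+\<omega>. f (X \<omega>) \<partial>M) = (\<Sum>n. f n * ennreal (prob {\<omega> \<in> space M. X \<omega> = n}))"
proof -
  have "(\<integral>\<^sup>+\<omega>. f (X \<omega>) \<partial>M)
      = (\<integral>\<^sup>+\<omega>. (\<Sum>n. f n * indicator {\<omega> \<in> space M. X \<omega> = n} \<omega>) \<partial>M)"
  proof (rule nn_integral_cong)
    fix \<omega> assume w: "\<omega> \<in> space M"
    have "(\<Sum>n. f n * indicator {\<omega> \<in> space M. X \<omega> = n} \<omega>)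
        = (\<Sum>n\<in>{X \<omega>}. f n * indicator {\<omega> \<in> space M. X \<omega> = n} \<omega>)"
      by (rule suminf_finite) (auto simp: indicator_def)
    then show "f (X \<omega>) = (\<Sum>n. f n * indicator {\<omega> \<in> space M. X \<omega> = n} \<omega>)"
      using w by simp
  qed
  also have "\<dots> = (\<Sum>n. \<integral>\<^sup>+\<omega>. f n * indicator {\<omega> \<in> space M. X \<omega> = n} \<omega> \<partial>M)"
    by (rule nn_integral_suminf) measurable
  also have "\<dots> = (\<Sum>n. f n * ennreal (prob {\<omega> \<in> space M. X \<omega> = n}))"
    by (simp add: nn_integral_cmult emeasure_eq_measure)
  finally show ?thesis .
qed

text \<open>
  The factor \<open>X\<close> removes the summand at \<open>0\<close>, so the truncated \<open>X - 1\<close> does no harm, and the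
  index shift \<open>n \<mapsto> n + 1\<close> matches the two series term by term. As the values are extended
  nonnegative reals, the identity also transfers finiteness from either side to the other.
\<close>

lemma (in prob_space) nn_integral_stein_identity:
  fixes X :: "'a \<Rightarrow> nat" and a :: "nat \<Rightarrow> real" and f :: "nat \<Rightarrow> ennreal"
  assumes X: "X \<in> measurable M (count_space UNIV)"
    and a: "\<And>n. a n \<ge> 0"
    and rec: "\<And>n. real (Suc n) * prob {\<omega> \<in> space M. X \<omega> = Suc n}
                = a n * prob {\<omega> \<in> space M. X \<omega> = n}"
  shows "(\<integral>\<^sup>+\<omega>. ennreal (real (X \<omega>)) * f (X \<omega> - 1) \<partial>M) = (\<integral>\<^sup>+\<omega>. ennreal (a (X \<omega>)) * f (X \<omega>) \<partial>M)"
proof -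
  let ?p = "\<lambda>n. prob {\<omega> \<in> space M. X \<omega> = n}"
  let ?g = "\<lambda>n. ennreal (real n) * f (n - 1) * ennreal (?p n)"
  have step: "?g (Suc n) = ennreal (a n) * f n * ennreal (?p n)" for n
  proof -
    have "?g (Suc n) = ennreal (real (Suc n) * ?p (Suc n)) * f n"
      by (subst ennreal_mult) (simp_all add: mult_ac del: of_nat_Suc)
    also have "\<dots> = ennreal (a n) * f n * ennreal (?p n)"
      unfolding rec using a by (subst ennreal_mult) (simp_all add: mult_ac)
    finally show ?thesis .
  qed
  have "(\<integral>\<^sup>+\<omega>. ennreal (real (X \<omega>)) * f (X \<omega> - 1) \<partial>M) = suminf ?g"
    by (rule nn_integral_nat_valued[OF X])
  also have "\<dots> = (\<Sum>n. ?g (Suc n))"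
    using suminf_offset[of ?g 1] by simp
  also have "\<dots> = (\<Sum>n. ennreal (a n) * f n * ennreal (?p n))"
    unfolding step ..
  also have "\<dots> = (\<integral>\<^sup>+\<omega>. ennreal (a (X \<omega>)) * f (X \<omega>) \<partial>M)"
    by (rule nn_integral_nat_valued[OF X, symmetric])
  finally show ?thesis .
qed

lemma (in prob_space) stein_identity:
  fixes X :: "'a \<Rightarrow> nat" and a f :: "nat \<Rightarrow> real"
  assumes X[measurable]: "X \<in> measurable M (count_space UNIV)"
    and a: "\<And>n. a n \<ge> 0"
    and rec: "\<And>n. real (Suc n) * prob {\<omega> \<in> space M. X \<omega> = Suc n}
                = a n * prob {\<omega> \<in> space M. X \<omega> = n}"
    and f: "\<And>n. f n \<ge> 0"
  shows "integrable M (\<lambda>\<omega>. real (X \<omega>) * f (X \<omega> - 1)) \<longleftrightarrow> integrable M (\<lambda>\<omega>. a (X \<omega>) * f (X \<omega>))"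
    and "expectation (\<lambda>\<omega>. real (X \<omega>) * f (X \<omega> - 1)) = expectation (\<lambda>\<omega>. a (X \<omega>) * f (X \<omega>))"
proof -
  have eq: "(\<integral>\<^sup>+\<omega>. ennreal (real (X \<omega>) * f (X \<omega> - 1)) \<partial>M) = (\<integral>\<^sup>+\<omega>. ennreal (a (X \<omega>) * f (X \<omega>)) \<partial>M)"
    using nn_integral_stein_identity[OF X a rec, of "\<lambda>n. ennreal (f n)"] a f
    by (simp add: ennreal_mult)
  show "integrable M (\<lambda>\<omega>. real (X \<omega>) * f (X \<omega> - 1)) \<longleftrightarrow> integrable M (\<lambda>\<omega>. a (X \<omega>) * f (X \<omega>))"
    using eq a f by (simp add: integrable_iff_bounded abs_mult)
  show "expectation (\<lambda>\<omega>. real (X \<omega>) * f (X \<omega> - 1)) = expectation (\<lambda>\<omega>. a (X \<omega>) * f (X \<omega>))"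
    using eq a f by (simp add: integral_eq_nn_integral)
qed

section \<open>Chebyshev's association inequality\<close>

text \<open>
  Let \<open>m = E X\<close> and let \<open>c = h \<lceil>m\<rceil>\<close>. As \<open>X\<close> has integer values, \<open>X - m\<close> and \<open>h(X) - c\<close>
  never have opposite signs, so \<open>0 \<le> E[(X - m)(h(X) - c)] = E[X h(X)] - m * E[h(X)]\<close>.
  This avoids an independent copy of \<open>X\<close>, and it settles the equality case: if every
  natural number has positive probability and the expectation is \<open>0\<close>, then the product vanishes
  at every \<open>n\<close>, so \<open>h n = c\<close> or \<open>n = m\<close>, and \<open>n = m\<close> also gives \<open>h n = c\<close>.
\<close>

lemma (in prob_space) expectation_mult_mono_ge:
  fixes X :: "'a \<Rightarrow> nat" and h :: "nat \<Rightarrow> real"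
  assumes X[measurable]: "X \<in> measurable M (count_space UNIV)"
    and h: "mono h"
    and iX: "integrable M (\<lambda>\<omega>. real (X \<omega>))"
    and ih: "integrable M (\<lambda>\<omega>. h (X \<omega>))"
    and iXh: "integrable M (\<lambda>\<omega>. real (X \<omega>) * h (X \<omega>))"
  shows "expectation (\<lambda>\<omega>. real (X \<omega>)) * expectation (\<lambda>\<omega>. h (X \<omega>))
           \<le> expectation (\<lambda>\<omega>. real (X \<omega>) * h (X \<omega>))"
    and "(\<And>n. prob {\<omega> \<in> space M. X \<omega> = n} > 0) \<Longrightarrow> \<not> h constant_on UNIV \<Longrightarrow>
         expectation (\<lambda>\<omega>. real (X \<omega>)) * expectation (\<lambda>\<omega>. h (X \<omega>))
           < expectation (\<lambda>\<omega>. real (X \<omega>) * h (X \<omega>))"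
proof -
  define m where "m = expectation (\<lambda>\<omega>. real (X \<omega>))"
  define k where "k = nat \<lceil>m\<rceil>"
  define g where "g n = (real n - m) * (h n - h k)" for n
  have m0: "m \<ge> 0"
    unfolding m_def by simp
  have above: "n \<ge> k" if "real n \<ge> m" for n
    using that m0 unfolding k_def by linarith
  have below: "n \<le> k" if "real n \<le> m" for n
    using that m0 unfolding k_def by linarith
  have g_nonneg: "g n \<ge> 0" for n
  proof (cases "real n \<ge> m")
    case True
    then show ?thesis
      using monoD[OF h above[OF True]] by (simp add: g_def)
  next
    case False
    then have "h n \<le> h k"
      using monoD[OF h below[of n]] by simp
    then show ?thesis
      using False by (simp add: g_def mult_nonpos_nonpos)
  qed
  have g_eq: "(\<lambda>\<omega>. g (X \<omega>))
      = (\<lambda>\<omega>. real (X \<omega>) * h (X \<omega>) - m * h (X \<omega>) - h k * real (X \<omega>) + m * h k)"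
    by (auto simp: g_def algebra_simps)
  have ig: "integrable M (\<lambda>\<omega>. g (X \<omega>))"
    unfolding g_eq using iX ih iXh by simp
  have Eg: "expectation (\<lambda>\<omega>. g (X \<omega>))
      = expectation (\<lambda>\<omega>. real (X \<omega>) * h (X \<omega>)) - m * expectation (\<lambda>\<omega>. h (X \<omega>))"
    unfolding g_eq using iX ih iXh by (simp add: prob_space m_def)
  have "expectation (\<lambda>\<omega>. g (X \<omega>)) \<ge> 0"
    by (simp add: g_nonneg)
  then show le: "expectation (\<lambda>\<omega>. real (X \<omega>)) * expectation (\<lambda>\<omega>. h (X \<omega>))
      \<le> expectation (\<lambda>\<omega>. real (X \<omega>) * h (X \<omega>))"
    using Eg by (simp add: m_def)
  assume supp: "\<And>n. prob {\<omega> \<in> space M. X \<omega> = n} > 0" and nc: "\<not> h constant_on UNIV"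
  have "expectation (\<lambda>\<omega>. g (X \<omega>)) \<noteq> 0"
  proof
    assume "expectation (\<lambda>\<omega>. g (X \<omega>)) = 0"
    then have ae: "AE \<omega> in M. g (X \<omega>) = 0"
      using integral_nonneg_eq_0_iff_AE[OF ig] g_nonneg by simp
    have "h n = h k" for n
    proof -
      have "g n = 0"
      proof (rule ccontr)
        assume "g n \<noteq> 0"
        with ae have "AE \<omega> in M. \<omega> \<notin> {\<omega> \<in> space M. X \<omega> = n}"
          by auto
        then have "prob {\<omega> \<in> space M. X \<omega> = n} = 0"
          by (subst prob_eq_0) auto
        with supp[of n] show False
          by simp
      qed
      then have "n = k \<or> h n = h k"
        using above[of n] below[of n] by (auto simp: g_def)
      then show ?thesis
        by auto
    qed
    with nc show False
      by (auto simp: constant_on_def)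
  qed
  with le Eg show "expectation (\<lambda>\<omega>. real (X \<omega>)) * expectation (\<lambda>\<omega>. h (X \<omega>))
      < expectation (\<lambda>\<omega>. real (X \<omega>) * h (X \<omega>))"
    by (simp add: m_def)
qed

section \<open>Dispersion\<close>

lemma (in prob_space) variance_minus_mean_eq_covariance:
  fixes X :: "'a \<Rightarrow> nat" and a :: "nat \<Rightarrow> real"
  assumes X[measurable]: "X \<in> measurable M (count_space UNIV)"
    and a: "\<And>n. a n \<ge> 0"
    and rec: "\<And>n. real (Suc n) * prob {\<omega> \<in> space M. X \<omega> = Suc n}
                = a n * prob {\<omega> \<in> space M. X \<omega> = n}"
    and iX: "integrable M (\<lambda>\<omega>. real (X \<omega>))"
    and iX2: "integrable M (\<lambda>\<omega>. (real (X \<omega>))\<^sup>2)"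
  shows "integrable M (\<lambda>\<omega>. a (X \<omega>))"
    and "integrable M (\<lambda>\<omega>. real (X \<omega>) * a (X \<omega>))"
    and "variance (\<lambda>\<omega>. real (X \<omega>)) - expectation (\<lambda>\<omega>. real (X \<omega>))
         = expectation (\<lambda>\<omega>. real (X \<omega>) * a (X \<omega>))
           - expectation (\<lambda>\<omega>. real (X \<omega>)) * expectation (\<lambda>\<omega>. a (X \<omega>))"
proof -
  have fact: "real n * real (n - 1) = (real n)\<^sup>2 - real n" for n
    by (cases n) (simp_all add: power2_eq_square algebra_simps)
  note S1 = stein_identity[OF X a rec, of "\<lambda>_. 1", simplified]
  note S2 = stein_identity[OF X a rec, of real, OF of_nat_0_le_iff, unfolded fact]
  show "integrable M (\<lambda>\<omega>. a (X \<omega>))"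
    using S1 iX by simp
  show "integrable M (\<lambda>\<omega>. real (X \<omega>) * a (X \<omega>))"
    using S2 iX iX2 by (simp add: mult.commute)
  have "expectation (\<lambda>\<omega>. (real (X \<omega>))\<^sup>2) - expectation (\<lambda>\<omega>. real (X \<omega>))
      = expectation (\<lambda>\<omega>. real (X \<omega>) * a (X \<omega>))"
    using S2 iX iX2 by (simp add: mult.commute)
  then show "variance (\<lambda>\<omega>. real (X \<omega>)) - expectation (\<lambda>\<omega>. real (X \<omega>))
      = expectation (\<lambda>\<omega>. real (X \<omega>) * a (X \<omega>))
        - expectation (\<lambda>\<omega>. real (X \<omega>)) * expectation (\<lambda>\<omega>. a (X \<omega>))"
    using S1 variance_eq[OF iX iX2] by (simp add: power2_eq_square)
qed

text \<open>
  For bounded \<open>a\<close> the Stein identity with \<open>f = 1\<close> bounds the mean by \<open>sup a\<close>; with \<open>f n = n\<close> it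
  then bounds the second factorial moment by \<open>sup a\<close> times the mean.
\<close>

lemma (in prob_space) integrable_square_if_bounded_ratio:
  fixes X :: "'a \<Rightarrow> nat" and a :: "nat \<Rightarrow> real"
  assumes X[measurable]: "X \<in> measurable M (count_space UNIV)"
    and a: "\<And>n. a n \<ge> 0"
    and rec: "\<And>n. real (Suc n) * prob {\<omega> \<in> space M. X \<omega> = Suc n}
                = a n * prob {\<omega> \<in> space M. X \<omega> = n}"
    and bd: "\<And>n. a n \<le> B"
  shows "integrable M (\<lambda>\<omega>. real (X \<omega>))" and "integrable M (\<lambda>\<omega>. (real (X \<omega>))\<^sup>2)"
proof -
  have fact: "real n * real (n - 1) = (real n)\<^sup>2 - real n" for n
    by (cases n) (simp_all add: power2_eq_square algebra_simps)
  note S1 = stein_identity(1)[OF X a rec, of "\<lambda>_. 1", simplified]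
  note S2 = stein_identity(1)[OF X a rec, of real, OF of_nat_0_le_iff, unfolded fact]
  have "integrable M (\<lambda>\<omega>. a (X \<omega>))"
    by (rule integrable_const_bound[of _ B]) (use a bd in auto)
  then show iX: "integrable M (\<lambda>\<omega>. real (X \<omega>))"
    using S1 by simp
  then have "integrable M (\<lambda>\<omega>. B * real (X \<omega>))"
    by simp
  then have "integrable M (\<lambda>\<omega>. a (X \<omega>) * real (X \<omega>))"
  proof (rule Bochner_Integration.integrable_bound)
    show "AE \<omega> in M. norm (a (X \<omega>) * real (X \<omega>)) \<le> norm (B * real (X \<omega>))"
      using a bd by (intro AE_I2) (auto simp: abs_mult intro!: mult_right_mono order_trans[OF bd])
  qed measurable
  then have "integrable M (\<lambda>\<omega>. (real (X \<omega>))\<^sup>2 - real (X \<omega>))"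
    using S2 by simp
  from Bochner_Integration.integrable_add[OF this iX]
  show "integrable M (\<lambda>\<omega>. (real (X \<omega>))\<^sup>2)"
    by simp
qed

text \<open>
  \<open>(Y - E Y)\<^sup>2\<close> and \<open>Y\<^sup>2\<close> differ by an integrable function, so the extended variance is
  infinite exactly when the second moment is.
\<close>

lemma (in prob_space) variance_to_mean_ratio_eq:
  fixes Y :: "'a \<Rightarrow> real"
  assumes iY: "integrable M Y" and pos: "expectation Y > 0"
  shows "variance_to_mean_ratio M Y =
    (if integrable M (\<lambda>\<omega>. (Y \<omega>)\<^sup>2) then ereal (variance Y / expectation Y) else \<infinity>)"
proof -
  let ?m = "expectation Y"
  have [measurable]: "Y \<in> borel_measurable M"
    using iY by simp
  have centre: "(Y \<omega> - ?m)\<^sup>2 = (Y \<omega>)\<^sup>2 - 2 * ?m * Y \<omega> + ?m\<^sup>2" for \<omega>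
    by (simp add: power2_eq_square algebra_simps)
  have square: "(Y \<omega>)\<^sup>2 = (Y \<omega> - ?m)\<^sup>2 + 2 * ?m * Y \<omega> - ?m\<^sup>2" for \<omega>
    by (simp add: power2_eq_square algebra_simps)
  have iff: "integrable M (\<lambda>\<omega>. (Y \<omega> - ?m)\<^sup>2) \<longleftrightarrow> integrable M (\<lambda>\<omega>. (Y \<omega>)\<^sup>2)"
  proof
    assume "integrable M (\<lambda>\<omega>. (Y \<omega>)\<^sup>2)"
    then show "integrable M (\<lambda>\<omega>. (Y \<omega> - ?m)\<^sup>2)"
      unfolding centre using iY by simp
  next
    assume "integrable M (\<lambda>\<omega>. (Y \<omega> - ?m)\<^sup>2)"
    then show "integrable M (\<lambda>\<omega>. (Y \<omega>)\<^sup>2)"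
      by (subst square) (use iY in simp)
  qed
  show ?thesis
  proof (cases "integrable M (\<lambda>\<omega>. (Y \<omega>)\<^sup>2)")
    case True
    then have "(\<integral>\<^sup>+\<omega>. ennreal ((Y \<omega> - ?m)\<^sup>2) \<partial>M) = ennreal (variance Y)"
      using iff by (intro nn_integral_eq_integral) auto
    then show ?thesis
      using True pos by (simp add: variance_to_mean_ratio_def)
  next
    case False
    then have "(\<integral>\<^sup>+\<omega>. ennreal ((Y \<omega> - ?m)\<^sup>2) \<partial>M) = \<infinity>"
      using iff by (auto simp: integrable_iff_bounded less_top[symmetric])
    then show ?thesis
      using False pos by (simp add: variance_to_mean_ratio_def)
  qed
qed

theorem theorem6p1:
  fixes \<phi> :: "real \<Rightarrow> real" and \<rho> :: real and M :: "'a measure" and X :: "'a \<Rightarrow> nat"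
  assumes phi_pos: "\<And>x. x > 0 \<Longrightarrow> \<phi> x > 0"
    and rho_pos: "\<rho> > 0"
    and Z_finite: "partition_Z_finite \<rho> \<phi>"
    and M: "prob_space M"
    and X: "X \<in> measurable M (count_space UNIV)"
    and pmf_0: "measure M {\<omega> \<in> space M. X \<omega> = 0} = 1 / partition_Z \<rho> \<phi>"
    and pmf_n: "\<And>n. n \<ge> 1 \<Longrightarrow>
      measure M {\<omega> \<in> space M. X \<omega> = n} = weight \<rho> \<phi> n * (1 / partition_Z \<rho> \<phi>)"
  shows "(mono_on {1..} (d_ratio \<phi>) \<and> integrable M (\<lambda>\<omega>. real (X \<omega>)) \<longrightarrow>
            variance_to_mean_ratio M (\<lambda>\<omega>. real (X \<omega>)) \<ge> 1 \<and>
            (\<not> d_ratio \<phi> constant_on {1..} \<longrightarrow> overdispersed M (\<lambda>\<omega>. real (X \<omega>))))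
       \<and> (antimono_on {1..} (d_ratio \<phi>) \<longrightarrow>
            integrable M (\<lambda>\<omega>. real (X \<omega>)) \<and>
            variance_to_mean_ratio M (\<lambda>\<omega>. real (X \<omega>)) \<le> 1 \<and>
            (\<not> d_ratio \<phi> constant_on {1..} \<longrightarrow> underdispersed M (\<lambda>\<omega>. real (X \<omega>))))"
proof -
  interpret prob_space M
    by (rule M)
  define Z where "Z = partition_Z \<rho> \<phi>"
  define a where "a n = \<rho> * d_ratio \<phi> (Suc n)" for n
  define p where "p n = prob {\<omega> \<in> space M. X \<omega> = n}" for n
  let ?Y = "\<lambda>\<omega>. real (X \<omega>)"
  let ?m = "expectation ?Y"
  note [measurable] = X
  have w_pos: "weight \<rho> \<phi> n > 0" for n
    unfolding weight_def using rho_pos by (auto intro!: divide_pos_pos prod_pos phi_pos)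
  have Z_pos: "Z > 0"
    using suminf_nonneg[OF Z_finite[unfolded partition_Z_finite_def]] w_pos
    by (simp add: Z_def partition_Z_def less_imp_le add_pos_nonneg)
  have p_eq: "p n = weight \<rho> \<phi> n / Z" for n
    using pmf_0 pmf_n[of n] by (cases "n = 0") (auto simp: p_def Z_def weight_def)
  have p_pos: "p n > 0" for n
    using w_pos Z_pos by (simp add: p_eq)
  have a_nonneg: "a n \<ge> 0" for n
    using rho_pos phi_pos[of "real (Suc n)"] by (simp add: a_def d_ratio_def)
  have rec: "real (Suc n) * p (Suc n) = a n * p n" for n
    by (simp add: p_eq weight_def a_def d_ratio_def mult_ac)
  have mean_pos: "?m > 0" if iX: "integrable M ?Y"
  proof (rule ccontr)
    assume "\<not> ?m > 0"
    then have "?m = 0"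
      by (simp add: not_less order_antisym)
    then have "AE \<omega> in M. ?Y \<omega> = 0"
      using integral_nonneg_eq_0_iff_AE[OF iX] by simp
    then have "AE \<omega> in M. \<omega> \<notin> {\<omega> \<in> space M. X \<omega> = 1}"
      by auto
    then have "p 1 = 0"
      unfolding p_def by (subst prob_eq_0) auto
    with p_pos[of 1] show False
      by simp
  qed
  have a_const: "d_ratio \<phi> constant_on {1..}" if "a constant_on UNIV"
  proof -
    from that obtain c where c: "\<And>n. a n = c"
      by (auto simp: constant_on_def)
    have "d_ratio \<phi> n = c / \<rho>" if "n \<ge> 1" for n
      using c[of "n - 1"] that rho_pos by (simp add: a_def field_simps)
    then show ?thesis
      by (auto simp: constant_on_def)
  qed
  note ratio = variance_to_mean_ratio_eq[of ?Y]
  note cov = variance_minus_mean_eq_covariance[OF X a_nonneg rec[unfolded p_def]]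
  show ?thesis
  proof (intro conjI impI; (elim conjE)?)
    assume d: "mono_on {1..} (d_ratio \<phi>)" and iX: "integrable M ?Y"
    have h: "mono a"
      using d rho_pos by (auto simp: mono_def a_def mono_on_def)
    note r = ratio[OF iX mean_pos[OF iX]]
    note C = expectation_mult_mono_ge[OF X h iX cov(1)[OF iX] cov(2)[OF iX]]
    show "variance_to_mean_ratio M ?Y \<ge> 1"
    proof (cases "integrable M (\<lambda>\<omega>. (?Y \<omega>)\<^sup>2)")
      case True
      then show ?thesis
        using r C(1) cov(3)[OF iX True] mean_pos[OF iX] by simp
    qed (simp add: r)
    assume nc: "\<not> d_ratio \<phi> constant_on {1..}"
    then have a_nc: "\<not> a constant_on UNIV"
      using a_const by blast
    have "variance_to_mean_ratio M ?Y > 1"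
    proof (cases "integrable M (\<lambda>\<omega>. (?Y \<omega>)\<^sup>2)")
      case True
      then show ?thesis
        using r C(2) a_nc p_pos cov(3)[OF iX True] mean_pos[OF iX] by (simp add: p_def)
    qed (simp add: r)
    then show "overdispersed M ?Y"
      using iX mean_pos[OF iX] by (simp add: overdispersed_def)
  next
    assume d: "antimono_on {1..} (d_ratio \<phi>)"
    have anti: "a n \<le> a k" if "k \<le> n" for k n
      using monotone_onD[OF d, of "Suc k" "Suc n"] that rho_pos by (simp add: a_def)
    \<comment> \<open>The association inequality for \<open>- a\<close> is the reversed inequality for \<open>a\<close>.\<close>
    then have h: "mono (\<lambda>n. - a n)"
      by (auto simp: mono_def)
    note bd = integrable_square_if_bounded_ratio[OF X a_nonneg rec[unfolded p_def], of "a 0", OF anti]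
    show iX: "integrable M ?Y"
      by (rule bd) simp
    have iX2: "integrable M (\<lambda>\<omega>. (?Y \<omega>)\<^sup>2)"
      by (rule bd) simp
    note cov = cov[OF iX iX2]
    have r: "variance_to_mean_ratio M ?Y = ereal (variance ?Y / ?m)"
      using ratio[OF iX mean_pos[OF iX]] iX2 by simp
    have ih: "integrable M (\<lambda>\<omega>. - a (X \<omega>))" "integrable M (\<lambda>\<omega>. ?Y \<omega> * - a (X \<omega>))"
      using cov(1,2) by simp_all
    note C = expectation_mult_mono_ge[OF X h iX ih]
    show "variance_to_mean_ratio M ?Y \<le> 1"
      using r C(1) cov(3) mean_pos[OF iX] by simp
    assume nc: "\<not> d_ratio \<phi> constant_on {1..}"
    have "\<not> (\<lambda>n. - a n) constant_on UNIV"
    proof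
      assume "(\<lambda>n. - a n) constant_on UNIV"
      then obtain c where "\<And>n. - a n = c"
        by (auto simp: constant_on_def)
      then have "a n = - c" for n
        by (metis minus_minus)
      then have "a constant_on UNIV"
        by (auto simp: constant_on_def)
      with a_const nc show False
        by blast
    qed
    then have "variance_to_mean_ratio M ?Y < 1"
      using r C(2) p_pos cov(3) mean_pos[OF iX] by (simp add: p_def)
    then show "underdispersed M ?Y"
      using iX mean_pos[OF iX] by (simp add: underdispersed_def)
  qed
qed

end
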